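(* Let $\Bbbk$ be a field and let $A$ be a prime $\Bbbk$-algebra with center $Z$. Assume that $Z$ is an affine (finitely generated) Cohen–Macaulay domain, that $A$ is a finitely generated $Z$-module, and that the regular trace $\mathrm{tr}$ of $A$ over $Z$ satisfies $\mathrm{tr}(A)\subseteq Z$. Suppose $d$ is an $\mathcal R$-discriminant of $A$ over $Z$. (1) If $g\in\mathrm{Aut}(A)$ ($\Bbbk$-algebra automorphisms), then $g(d)=_{A^\times}d$. (2) Suppose that $\mathrm{char}\,\Bbbk=0$ and $A^\times=\Bbbk^\times$. If $\delta$ is a locally nilpotent derivation of $A$, then $\delta(d)=0$.
   Context: $A^\times$ is the group of units of $A$; $f=_{A^\times}g$ means $f=cg$ for some $c\in A^\times$. A derivation of $A$ is a $\Bbbk$-linear map $\delta:A\to A$ with $\delta(ab)=\delta(a)b+a\delta(b)$; it is locally nilpotent if for each $a\in A$ there is $n\in\mathbb N$ with $\delta^n(a)=0$. Let $F$ be the fraction field of $Z$, $A_F=A\otimes_Z F$, $w=\dim_F A_F$. The regular trace $\mathrm{tr}:A\to F$ sends $a$ to the trace of left multiplication by $a$ on $A_F$. The modified discriminant ideal $\mathrm{MD}(A/Z)$ is the ideal of $Z$ generated by all $\det\big(\mathrm{tr}(u_iu_j')\big)_{i,j=1}^w$, where $\{u_i\}_{i=1}^w$ and $\{u_i'\}_{i=1}^w$ range over all $w$-element subsets of $A$. For a $Z$-module $M$ put $M^\vee=\mathrm{Hom}_Z(M,Z)$. For an ideal $I$ of $Z$, the reflexive hull $I^{\vee\vee}$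 is viewed as an ideal of $Z$ containing $I$. An element $d\in Z$ is an $\mathcal R$-discriminant (reflexive hull discriminant) of $A$ over $Z$ if $\mathrm{MD}(A/Z)^{\vee\vee}=dZ$. *)

theory Defs
  imports
    "HOL-Library.Poly_Mapping"
    "HOL-Library.Function_Algebras"
    "HOL-Library.Extended_Nat"
    "HOL-Computational_Algebra.Computational_Algebra"
    "HOL-Algebra.Ring_Divisibility"
    "Jordan_Normal_Form.Determinant"
begin

section \<open>Prime rings and their centers\<close>

class prime_ring = ring_1 +
  assumes prime_ring: "(\<And>x. a * x * b = 0) \<Longrightarrow> a = 0 \<or> b = 0"

typedef (overloaded) ('a::ring_1) center = "{z::'a. \<forall>a. z * a = a * z}"
  morphisms of_center Abs_center
  by (rule exI[of _ 0]) simp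

setup_lifting type_definition_center

lemma of_center_commute: "of_center z * a = a * of_center z"
  using of_center[of z] by simp

instantiation center :: (ring_1) comm_ring_1
begin

lift_definition zero_center :: "'a center" is 0 by simp
lift_definition one_center :: "'a center" is 1 by simp
lift_definition plus_center :: "'a center \<Rightarrow> 'a center \<Rightarrow> 'a center" is "(+)"
  by (auto simp only: mem_Collect_eq distrib_left distrib_right)
lift_definition minus_center :: "'a center \<Rightarrow> 'a center \<Rightarrow> 'a center" is "(-)"
  by (auto simp only: mem_Collect_eq left_diff_distrib right_diff_distrib)
lift_definition uminus_center :: "'a center \<Rightarrow> 'a center" is uminus
  by (auto simp only: mem_Collect_eq minus_mult_left[symmetric] minus_mult_right[symmetric])
lift_definition times_center :: "'a center \<Rightarrow> 'a center \<Rightarrow> 'a center" is "(*)"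
proof -
  fix y z a :: 'a
  assume y: "\<And>a. y * a = a * y" and z: "\<And>a. z * a = a * z"
  have "y * z * a = y * (a * z)"
    by (simp only: mult.assoc z[of a])
  also have "\<dots> = a * (y * z)"
    by (simp only: mult.assoc[symmetric] y[of a])
  finally show "y * z * a = a * (y * z)" .
qed

instance
proof
  fix a b c :: "'a center"
  note rep = of_center_inject[symmetric] plus_center.rep_eq minus_center.rep_eq
    uminus_center.rep_eq times_center.rep_eq zero_center.rep_eq one_center.rep_eq
  show "a * b * c = a * (b * c)" by (simp only: rep mult.assoc)
  show "a * b = b * a" unfolding rep by (rule of_center_commute)
  show "1 * a = a" by (simp only: rep mult_1_left)
  show "a + b + c = a + (b + c)" by (simp only: rep add.assoc)
  show "a + b = b + a" by (simp only: rep add.commute)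
  show "0 + a = a" by (simp only: rep add_0_left)
  show "- a + a = 0" by (simp only: rep left_minus)
  show "a - b = a + - b" by (simp only: rep diff_conv_add_uminus)
  show "(a + b) * c = a * c + b * c" by (simp only: rep distrib_right)
  show "(0 :: 'a center) \<noteq> 1" by (simp only: rep zero_neq_one not_False_eq_True)
qed

end

instance center :: (prime_ring) idom
proof
  fix a b :: "'a center"
  assume nz: "a \<noteq> 0" "b \<noteq> 0"
  show "a * b \<noteq> 0"
  proof
    assume "a * b = 0"
    then have ab: "of_center a * of_center b = 0"
      by (metis times_center.rep_eq zero_center.rep_eq)
    have "of_center a * x * of_center b = 0" for x
      by (simp add: of_center_commute[of a x] mult.assoc ab)
    then have "of_center a = 0 \<or> of_center b = 0"
      by (rule prime_ring)
    with nz show False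
      by (metis of_center_inject zero_center.rep_eq)
  qed
qed

definition center_scale :: "'a::ring_1 center \<Rightarrow> 'a \<Rightarrow> 'a"
  where "center_scale z a = of_center z * a"

definition finite_over_center :: "'a::ring_1 itself \<Rightarrow> bool"
  where "finite_over_center _ \<longleftrightarrow>
    (\<exists>X :: 'a set. finite X \<and> module.span center_scale X = UNIV)"

lemma module_center_scale: "Modules.module center_scale"
  by standard
    (simp_all add: center_scale_def plus_center.rep_eq times_center.rep_eq one_center.rep_eq
      distrib_left distrib_right mult.assoc)

section \<open>Algebras over a field\<close>

locale field_algebra = vector_space scale
  for scale :: "'k::field \<Rightarrow> 'a::ring_1 \<Rightarrow> 'a" +
  assumes scale_mult_left: "scale c a * b = scale c (a * b)"
    and scale_mult_right: "a * scale c b = scale c (a * b)"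

definition subalgebra :: "('k::field \<Rightarrow> 'a::ring_1 \<Rightarrow> 'a) \<Rightarrow> 'a set \<Rightarrow> bool"
  where "subalgebra scale S \<longleftrightarrow>
    module.subspace scale S \<and> 1 \<in> S \<and> (\<forall>a\<in>S. \<forall>b\<in>S. a * b \<in> S)"

definition affine_subalgebra :: "('k::field \<Rightarrow> 'a::ring_1 \<Rightarrow> 'a) \<Rightarrow> 'a set \<Rightarrow> bool"
  where "affine_subalgebra scale S \<longleftrightarrow> (\<exists>X. finite X \<and> subalgebra scale hull X = S)"

definition algebra_automorphism ::
    "('k::field \<Rightarrow> 'a::ring_1 \<Rightarrow> 'a) \<Rightarrow> ('a \<Rightarrow> 'a) \<Rightarrow> bool"
  where "algebra_automorphism scale g \<longleftrightarrow>
    Vector_Spaces.linear scale scale g \<and> bij g \<and> g 1 = 1 \<and> (\<forall>a b. g (a * b) = g a * g b)"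

definition derivation ::
    "('k::field \<Rightarrow> 'a::ring_1 \<Rightarrow> 'a) \<Rightarrow> ('a \<Rightarrow> 'a) \<Rightarrow> bool"
  where "derivation scale \<delta> \<longleftrightarrow>
    Vector_Spaces.linear scale scale \<delta> \<and> (\<forall>a b. \<delta> (a * b) = \<delta> a * b + a * \<delta> b)"

definition locally_nilpotent :: "('a::zero \<Rightarrow> 'a) \<Rightarrow> bool"
  where "locally_nilpotent \<delta> \<longleftrightarrow> (\<forall>a. \<exists>n. (\<delta> ^^ n) a = 0)"

definition unit_group :: "'a::ring_1 set"
  where "unit_group = {c. \<exists>c'. c * c' = 1 \<and> c' * c = 1}"

definition eq_up_to_unit :: "'a::ring_1 \<Rightarrow> 'a \<Rightarrow> bool"
  where "eq_up_to_unit f g \<longleftrightarrow> (\<exists>c\<in>unit_group. f = c * g)"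

section \<open>Cohen--Macaulay domains\<close>

definition ring_on :: "'r::comm_ring_1 set \<Rightarrow> 'r ring"
  where "ring_on S = \<lparr>carrier = S, mult = (*), one = 1, zero = 0, add = (+)\<rparr>"

text \<open>The localization of a domain at the complement of \<open>p\<close>, as a subring of its fraction field.\<close>

definition localization_at :: "'r::idom set \<Rightarrow> 'r fract ring"
  where "localization_at p = ring_on {Fract a s | a s. s \<notin> p}"

definition krull_dim :: "('r, 'm) ring_scheme \<Rightarrow> enat"
  where "krull_dim R = Sup {enat n | n.
    \<exists>P :: nat \<Rightarrow> 'r set. (\<forall>i\<le>n. primeideal (P i) R) \<and> (\<forall>i<n. P i \<subset> P (Suc i))}"

text \<open>\<open>xs ! i\<close> is required to be a non-zero-divisor on \<open>R / (xs ! 0, \<dots>, xs ! (i - 1))\<close>.\<close>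

definition regular_sequence :: "('r, 'm) ring_scheme \<Rightarrow> 'r list \<Rightarrow> bool"
  where "regular_sequence R xs \<longleftrightarrow>
    set xs \<subseteq> carrier R \<and> genideal R (set xs) \<noteq> carrier R \<and>
    (\<forall>i<length xs. \<forall>r\<in>carrier R.
      xs ! i \<otimes>\<^bsub>R\<^esub> r \<in> genideal R (set (take i xs)) \<longrightarrow> r \<in> genideal R (set (take i xs)))"

definition ideal_depth :: "('r, 'm) ring_scheme \<Rightarrow> 'r set \<Rightarrow> enat"
  where "ideal_depth R I = Sup {enat (length xs) | xs. regular_sequence R xs \<and> set xs \<subseteq> I}"

definition cohen_macaulay_local :: "('r, 'm) ring_scheme \<Rightarrow> bool"
  where "cohen_macaulay_local R \<longleftrightarrow>
    cring R \<and> noetherian_ring R \<and>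
    (\<exists>m. maximalideal m R \<and> (\<forall>m'. maximalideal m' R \<longrightarrow> m' = m) \<and> ideal_depth R m = krull_dim R)"

definition cohen_macaulay_domain :: "'r::idom itself \<Rightarrow> bool"
  where "cohen_macaulay_domain _ \<longleftrightarrow>
    noetherian_ring (ring_on (UNIV :: 'r set)) \<and>
    (\<forall>m. maximalideal m (ring_on (UNIV :: 'r set)) \<longrightarrow> cohen_macaulay_local (localization_at m))"

section \<open>Extension of scalars to the fraction field of the center\<close>

text \<open>
  For \<open>Z\<close> the center of \<open>A\<close> and \<open>F\<close> its fraction field, \<open>A \<otimes>\<^sub>Z F\<close> is the free abelian group
  on \<open>A \<times> F\<close> modulo the subgroup generated by the bilinearity relations.
\<close>

inductive_set tensor_relations :: "(('a::prime_ring \<times> 'a center fract) \<Rightarrow>\<^sub>0 int) set"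
  where
    zero: "0 \<in> tensor_relations"
  | diff: "x \<in> tensor_relations \<Longrightarrow> y \<in> tensor_relations \<Longrightarrow> x - y \<in> tensor_relations"
  | add_left: "frag_of (a + b, f) - frag_of (a, f) - frag_of (b, f) \<in> tensor_relations"
  | add_right: "frag_of (a, f + g) - frag_of (a, f) - frag_of (a, g) \<in> tensor_relations"
  | balanced: "frag_of (of_center z * a, f) - frag_of (a, to_fract z * f) \<in> tensor_relations"

lemma tensor_relations_uminus: "x \<in> tensor_relations \<Longrightarrow> - x \<in> tensor_relations"
  using tensor_relations.diff[OF tensor_relations.zero] by fastforce

lemma tensor_relations_add:
  "x \<in> tensor_relations \<Longrightarrow> y \<in> tensor_relations \<Longrightarrow> x + y \<in> tensor_relations"
  using tensor_relations.diff[of x "- y"] tensor_relations_uminus by fastforce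

quotient_type (overloaded) 'a frac_ext =
  "('a::prime_ring \<times> 'a center fract) \<Rightarrow>\<^sub>0 int" / "\<lambda>x y. x - y \<in> tensor_relations"
proof (rule equivpI)
  show "reflp (\<lambda>x y. x - y \<in> tensor_relations)"
    by (simp add: reflp_def tensor_relations.zero)
  show "symp (\<lambda>x y. x - y \<in> tensor_relations)"
    using tensor_relations_uminus by (fastforce simp: symp_def)
  show "transp (\<lambda>x y. x - y \<in> tensor_relations)"
    using tensor_relations_add by (fastforce simp: transp_def)
qed

instantiation frac_ext :: (prime_ring) ab_group_add
begin

lift_definition zero_frac_ext :: "'a frac_ext" is 0 .
lift_definition plus_frac_ext :: "'a frac_ext \<Rightarrow> 'a frac_ext \<Rightarrow> 'a frac_ext" is "(+)"
  unfolding add_diff_add by (rule tensor_relations_add)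
lift_definition uminus_frac_ext :: "'a frac_ext \<Rightarrow> 'a frac_ext" is uminus
  unfolding minus_diff_minus by (rule tensor_relations_uminus)
lift_definition minus_frac_ext :: "'a frac_ext \<Rightarrow> 'a frac_ext \<Rightarrow> 'a frac_ext" is "(-)"
proof -
  fix x x' y y' :: "('a \<times> 'a center fract) \<Rightarrow>\<^sub>0 int"
  assume "x - x' \<in> tensor_relations" "y - y' \<in> tensor_relations"
  then have "(x - x') - (y - y') \<in> tensor_relations"
    by (rule tensor_relations.diff)
  also have "(x - x') - (y - y') = (x - y) - (x' - y')"
    by (simp add: algebra_simps)
  finally show "(x - y) - (x' - y') \<in> tensor_relations" .
qed

lemma frac_ext_cases [case_names abs]:
  obtains x where "t = abs_frac_ext x"
  using Quotient3_abs_rep[OF Quotient3_frac_ext, of t] by metis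

instance
proof
  fix a b c :: "'a frac_ext"
  show "a + b + c = a + (b + c)"
    by (cases a rule: frac_ext_cases, cases b rule: frac_ext_cases, cases c rule: frac_ext_cases)
      (simp add: plus_frac_ext.abs_eq add.assoc)
  show "a + b = b + a"
    by (cases a rule: frac_ext_cases, cases b rule: frac_ext_cases)
      (simp add: plus_frac_ext.abs_eq add.commute)
  show "0 + a = a"
    by (cases a rule: frac_ext_cases) (simp add: plus_frac_ext.abs_eq zero_frac_ext.abs_eq)
  show "- a + a = 0"
    by (cases a rule: frac_ext_cases)
      (simp add: plus_frac_ext.abs_eq zero_frac_ext.abs_eq uminus_frac_ext.abs_eq)
  show "a - b = a + - b"
    by (cases a rule: frac_ext_cases, cases b rule: frac_ext_cases)
      (simp add: plus_frac_ext.abs_eq minus_frac_ext.abs_eq uminus_frac_ext.abs_eq)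
qed

end

definition tensor :: "'a::prime_ring \<Rightarrow> 'a center fract \<Rightarrow> 'a frac_ext"
  where "tensor a f = abs_frac_ext (frag_of (a, f))"

definition frac_scale :: "'a::prime_ring center fract \<Rightarrow> 'a frac_ext \<Rightarrow> 'a frac_ext"
  where "frac_scale h t =
    abs_frac_ext (frag_extend (\<lambda>(a, f). frag_of (a, h * f)) (rep_frac_ext t))"

definition left_mult :: "'a::prime_ring \<Rightarrow> 'a frac_ext \<Rightarrow> 'a frac_ext"
  where "left_mult b t =
    abs_frac_ext (frag_extend (\<lambda>(a, f). frag_of (b * a, f)) (rep_frac_ext t))"

lemma rep_abs_frac_ext: "rep_frac_ext (abs_frac_ext x) - x \<in> tensor_relations"
  using Quotient3_rep_abs[OF Quotient3_frac_ext, of x] by (simp add: tensor_relations.zero)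

lemma abs_frac_ext_cong:
  assumes "\<And>x. x \<in> tensor_relations \<Longrightarrow> frag_extend \<phi> x \<in> tensor_relations"
  shows "abs_frac_ext (frag_extend \<phi> (rep_frac_ext (abs_frac_ext x))) = abs_frac_ext (frag_extend \<phi> x)"
  using assms[OF rep_abs_frac_ext[of x]] by (simp add: frac_ext.abs_eq_iff frag_extend_diff)

lemma frac_scale_abs:
  "frac_scale h (abs_frac_ext x) = abs_frac_ext (frag_extend (\<lambda>(a, f). frag_of (a, h * f)) x)"
  unfolding frac_scale_def
proof (rule abs_frac_ext_cong)
  fix x :: "('a \<times> 'a center fract) \<Rightarrow>\<^sub>0 int"
  assume "x \<in> tensor_relations"
  then show "frag_extend (\<lambda>(a, f). frag_of (a, h * f)) x \<in> tensor_relations"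
  proof induction
    case (balanced z a f)
    show ?case
      using tensor_relations.balanced[of z a "h * f"]
      by (simp add: frag_extend_diff mult.left_commute)
  next
    case (add_left a a' f)
    show ?case
      using tensor_relations.add_left[of a a' "h * f"]
      by (simp add: frag_extend_diff)
  next
    case (add_right a f g)
    show ?case
      using tensor_relations.add_right[of a "h * f" "h * g"]
      by (simp add: frag_extend_diff distrib_left)
  next
    case (diff x y)
    then show ?case
      unfolding frag_extend_diff by (intro tensor_relations.diff)
  next
    case zero
    show ?case
      by (simp add: tensor_relations.zero)
  qed
qed

lemma left_mult_abs:
  "left_mult b (abs_frac_ext x) = abs_frac_ext (frag_extend (\<lambda>(a, f). frag_of (b * a, f)) x)"
  unfolding left_mult_def
proof (rule abs_frac_ext_cong)
  fix x :: "('a \<times> 'a center fract) \<Rightarrow>\<^sub>0 int"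
  assume "x \<in> tensor_relations"
  then show "frag_extend (\<lambda>(a, f). frag_of (b * a, f)) x \<in> tensor_relations"
  proof induction
    case (balanced z a f)
    have "b * (of_center z * a) = of_center z * (b * a)"
      by (simp add: mult.assoc[symmetric] of_center_commute[of z b])
    then show ?case
      using tensor_relations.balanced[of z "b * a" f] by (simp add: frag_extend_diff)
  next
    case (add_left a a' f)
    show ?case
      using tensor_relations.add_left[of "b * a" "b * a'" f]
      by (simp add: frag_extend_diff distrib_left)
  next
    case (add_right a f g)
    show ?case
      using tensor_relations.add_right[of "b * a" f g]
      by (simp add: frag_extend_diff)
  next
    case (diff x y)
    then show ?case
      unfolding frag_extend_diff by (intro tensor_relations.diff)
  next
    case zero
    show ?case
      by (simp add: tensor_relations.zero)
  qed
qed

lemma frac_scale_tensor: "frac_scale h (tensor a f) = tensor a (h * f)"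
  by (simp add: tensor_def frac_scale_abs)

lemma left_mult_tensor: "left_mult b (tensor a f) = tensor (b * a) f"
  by (simp add: tensor_def left_mult_abs)

lemma tensor_add_left: "tensor (a + b) f = tensor a f + tensor b f"
  using tensor_relations.add_left[of a b f]
  by (simp add: tensor_def plus_frac_ext.abs_eq frac_ext.abs_eq_iff diff_diff_eq)

lemma tensor_add_right: "tensor a (f + g) = tensor a f + tensor a g"
  using tensor_relations.add_right[of a f g]
  by (simp add: tensor_def plus_frac_ext.abs_eq frac_ext.abs_eq_iff diff_diff_eq)

lemma tensor_balanced: "tensor (of_center z * a) f = tensor a (to_fract z * f)"
  using tensor_relations.balanced[of z a f] by (simp add: tensor_def frac_ext.abs_eq_iff)

lemma frac_ext_induct [case_names zero tensor diff]:
  assumes "P 0" "\<And>a f. P (tensor a f)" "\<And>x y. P x \<Longrightarrow> P y \<Longrightarrow> P (x - y)"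
  shows "P t"
proof -
  have "P (abs_frac_ext x)" for x
  proof (induction x rule: frag_induction[OF subset_UNIV, case_names zero one diff])
    case zero
    then show ?case using assms(1) by (simp add: zero_frac_ext.abs_eq)
  next
    case (one x)
    then show ?case using assms(2) by (cases x) (simp add: tensor_def)
  next
    case (diff x y)
    then show ?case using assms(3)[of "abs_frac_ext x" "abs_frac_ext y"] by (simp add: minus_frac_ext.abs_eq)
  qed
  then show ?thesis
    by (cases t rule: frac_ext_cases) simp
qed

lemma frac_scale_diff: "frac_scale h (s - t) = frac_scale h s - frac_scale h t"
proof -
  obtain x y where "s = abs_frac_ext x" "t = abs_frac_ext y"
    by (meson frac_ext_cases)
  then show ?thesis
    by (simp add: minus_frac_ext.abs_eq frac_scale_abs frag_extend_diff)
qed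

lemma frac_scale_add: "frac_scale h (s + t) = frac_scale h s + frac_scale h t"
proof -
  obtain x y where "s = abs_frac_ext x" "t = abs_frac_ext y"
    by (meson frac_ext_cases)
  then show ?thesis
    by (simp add: plus_frac_ext.abs_eq frac_scale_abs frag_extend_add)
qed

lemma left_mult_diff: "left_mult b (s - t) = left_mult b s - left_mult b t"
proof -
  obtain x y where "s = abs_frac_ext x" "t = abs_frac_ext y"
    by (meson frac_ext_cases)
  then show ?thesis
    by (simp add: minus_frac_ext.abs_eq left_mult_abs frag_extend_diff)
qed

lemma left_mult_add: "left_mult b (s + t) = left_mult b s + left_mult b t"
proof -
  obtain x y where "s = abs_frac_ext x" "t = abs_frac_ext y"
    by (meson frac_ext_cases)
  then show ?thesis
    by (simp add: plus_frac_ext.abs_eq left_mult_abs frag_extend_add)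
qed

lemma vector_space_frac_scale: "vector_space frac_scale"
proof
  fix g h :: "'a center fract" and s t :: "'a frac_ext"
  have zero: "frac_scale k 0 = 0" for k :: "'a center fract"
    using frac_scale_diff[of k 0 0] by simp
  show "frac_scale g (s + t) = frac_scale g s + frac_scale g t"
    by (rule frac_scale_add)
  show "frac_scale (g + h) t = frac_scale g t + frac_scale h t"
    by (induction t rule: frac_ext_induct)
      (simp_all add: zero frac_scale_diff frac_scale_tensor distrib_right tensor_add_right)
  show "frac_scale g (frac_scale h t) = frac_scale (g * h) t"
    by (induction t rule: frac_ext_induct)
      (simp_all add: zero frac_scale_diff frac_scale_tensor mult.assoc)
  show "frac_scale 1 t = t"
    by (induction t rule: frac_ext_induct)
      (simp_all add: zero frac_scale_diff frac_scale_tensor)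
qed

interpretation frac_ext: vector_space frac_scale
  by (rule vector_space_frac_scale)

lemma linear_left_mult: "Vector_Spaces.linear frac_scale frac_scale (left_mult b)"
proof -
  have zero: "left_mult b 0 = 0"
    using left_mult_diff[of b 0 0] by simp
  have "left_mult b (frac_scale h t) = frac_scale h (left_mult b t)" for h t
    by (induction t rule: frac_ext_induct)
      (simp_all add: zero frac_scale_diff left_mult_diff frac_scale_tensor left_mult_tensor)
  then show ?thesis
    by unfold_locales (simp_all add: left_mult_add)
qed

section \<open>Regular trace and discriminants\<close>

text \<open>Independent of the chosen basis; in infinite dimension the value is \<open>0\<close> by convention.\<close>

definition (in vector_space) endo_trace :: "('b \<Rightarrow> 'b) \<Rightarrow> 'a"
  where "endo_trace T =
    (let B = extend_basis {} in \<Sum>b\<in>B. representation B (T b) b)"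

definition regular_trace :: "'a::prime_ring \<Rightarrow> 'a center fract"
  where "regular_trace a = vector_space.endo_trace frac_scale (left_mult a)"

definition regular_rank :: "'a::prime_ring itself \<Rightarrow> nat"
  where "regular_rank _ = vector_space.dim frac_scale (UNIV :: 'a frac_ext set)"

text \<open>
  The determinants are a priori elements of the fraction field; the generators are those lying in
  the center, which is all of them as soon as the regular trace takes values in the center.
\<close>

definition modified_discriminant_ideal :: "'a::prime_ring itself \<Rightarrow> 'a center set"
  where "modified_discriminant_ideal _ =
    genideal (ring_on UNIV) {z. \<exists>u u' :: nat \<Rightarrow> 'a. let w = regular_rank TYPE('a) in
      inj_on u {..<w} \<and> inj_on u' {..<w} \<and>
      to_fract z = det (mat w w (\<lambda>(i, j). regular_trace (u i * u' j)))}"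

text \<open>
  \<open>Hom(M, R)\<close> for a submodule \<open>M\<close>; homomorphisms are made to vanish outside \<open>M\<close>, so that they form
  a set with the pointwise module structure.
\<close>

definition dual ::
    "('r::comm_ring_1 \<Rightarrow> 'm::ab_group_add \<Rightarrow> 'm) \<Rightarrow> 'm set \<Rightarrow> ('m \<Rightarrow> 'r) set"
  where "dual scale M = {f.
    (\<forall>x\<in>M. \<forall>y\<in>M. f (x + y) = f x + f y) \<and>
    (\<forall>r. \<forall>x\<in>M. f (scale r x) = r * f x) \<and>
    (\<forall>x. x \<notin> M \<longrightarrow> f x = 0)}"

text \<open>
  The inclusion \<open>I \<subseteq> R\<close> induces a map from the double dual of \<open>I\<close> to that of \<open>R\<close>, which is
  \<open>R\<close> itself. It sends \<open>\<phi>\<close> to its value at the inclusion \<open>I \<rightarrow> R\<close>, seen as an element of the dual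
  of \<open>I\<close>. The reflexive hull is the image of this map.
\<close>

definition reflexive_hull :: "'r::comm_ring_1 set \<Rightarrow> 'r set"
  where "reflexive_hull I =
    {\<phi> (\<lambda>x. if x \<in> I then x else 0) | \<phi>. \<phi> \<in> dual (\<lambda>r f x. r * f x) (dual (*) I)}"

definition R_discriminant :: "'a::prime_ring center \<Rightarrow> bool"
  where "R_discriminant d \<longleftrightarrow>
    reflexive_hull (modified_discriminant_ideal TYPE('a)) = range (\<lambda>z. d * z)"

end

theory Submission
  imports Defs
begin

text \<open>
  An automorphism of \<open>A\<close> restricts to the center, extends to its fraction field \<open>F\<close>, and acts
  semilinearly on \<open>A \<otimes> F\<close>. It therefore commutes with the regular trace, preserves the modified
  discriminant ideal and the reflexive hull of that ideal, and sends the generator \<open>d\<close> to another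
  generator. For a locally nilpotent derivation \<open>\<delta>\<close> in characteristic 0 this applies to the
  automorphism \<open>exp \<delta>\<close>: if all units of \<open>A\<close> are scalars, \<open>d\<close> is an eigenvector of \<open>exp \<delta>\<close>, which is
  locally unipotent, so \<open>\<delta> d = 0\<close>.
\<close>

section \<open>Equivariance of the discriminant\<close>

lemma the_inv_eqI:
  assumes "\<And>x. h (f x) = x" and "\<And>y. f (h y) = y"
  shows "the_inv f = h"
proof
  fix y
  have "inj f"
    using assms(1) by (rule inj_on_inverseI)
  then show "the_inv f y = h y"
    using the_inv_f_f[of f "h y"] assms(2) by simp
qed

text \<open>Instantiated by the automorphism itself, by its restriction to the center and by the
  induced map on fractions. Since \<open>the_inv g\<close> is again an instance, an inclusion or
  divisibility proved for all automorphisms can be reversed.\<close>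

locale ring_automorphism = ring_hom g
  for g :: "'a::ring_1 \<Rightarrow> 'a" +
  assumes bij: "bij g"
begin

lemma inv_apply [simp]: "the_inv g (g a) = a" "g (the_inv g a) = a"
  using bij by (simp_all add: bij_is_inj bij_is_surj the_inv_f_f f_the_inv_into_f)

lemma inv_inv: "the_inv (the_inv g) = g"
  by (rule the_inv_eqI) simp_all

lemma inv_eq_iff: "the_inv g a = b \<longleftrightarrow> a = g b"
  by (metis inv_apply)

lemma apply_eq_iff [simp]: "g a = g b \<longleftrightarrow> a = b"
  by (metis inv_apply(1))

lemma apply_eq_0_iff [simp]: "g a = 0 \<longleftrightarrow> a = 0"
  using apply_eq_iff[of a 0] by simp

lemma ring_automorphism_inv: "ring_automorphism (the_inv g)"
proof
  show "bij (the_inv g)"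
    using bij by (rule bij_betw_the_inv_into)
qed (simp_all add: inv_eq_iff hom_distribs)

end

text \<open>
  Both traces refer to the same basis \<open>B\<close>, which \<open>G\<close> need not preserve, so the proof contains the
  basis independence of the trace: vectors are expanded in \<open>B\<close> and in \<open>G ` B\<close>, and the double sum
  is swapped. In infinite dimension both sides are \<open>0\<close>.
\<close>

lemma (in vector_space) endo_trace_semilinear:
  assumes \<sigma>: "ring_automorphism \<sigma>"
    and G: "bij G" "\<And>x y. G (x + y) = G x + G y" "\<And>c x. G (c *s x) = \<sigma> c *s G x"
    and T': "Vector_Spaces.linear (*s) (*s) T'"
    and T'_G: "\<And>x. T' (G x) = G (T x)"
  shows "endo_trace T' = \<sigma> (endo_trace T)"
proof -
  interpret \<sigma>: ring_automorphism \<sigma> by fact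
  interpret T': Vector_Spaces.linear "(*s)" "(*s)" T' by fact
  define B where "B = extend_basis {}"
  have B: "independent B" "span B = UNIV"
    by (simp_all add: B_def independent_extend_basis span_extend_basis independent_empty)
  show ?thesis
  proof (cases "finite B")
    case False
    then show ?thesis
      by (simp add: endo_trace_def B_def Let_def)
  next
    case True
    define R where "R = representation B"
    have R: "R (x + y) b = R x b + R y b" "R (c *s x) b = c * R x b" "R 0 b = 0"
      "(\<Sum>b\<in>B. R x b *s b) = x" for x y c b
      unfolding R_def using B True
      by (simp_all add: representation_add representation_scale representation_zero sum_representation_eq)
    have R_sum: "R (sum f B) b = (\<Sum>c\<in>B. R (f c) b)" for f b
      unfolding R_def using B by (simp add: representation_sum)
    define H where "H = the_inv G"
    have GH: "G (H x) = x" "H (G x) = x" for x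
      using G(1) by (simp_all add: H_def bij_is_inj bij_is_surj the_inv_f_f f_the_inv_into_f)
    have inj: "G x = G y \<longleftrightarrow> x = y" for x y
      by (metis GH(2))
    have G0: "G 0 = 0"
      using G(2)[of 0 0] by simp
    have G_sum: "G (sum f B) = (\<Sum>b\<in>B. G (f b))" for f
      using True by (induction B) (simp_all add: G0 G(2))
    define E where "E x c = \<sigma> (R (H x) c)" for x c
    have E_sum: "E (\<Sum>b\<in>B. f b *s x b) c = (\<Sum>b\<in>B. f b * E (x b) c)" for f x c
    proof -
      have "H (\<Sum>b\<in>B. f b *s x b) = (\<Sum>b\<in>B. the_inv \<sigma> (f b) *s H (x b))"
        by (subst inj[symmetric]) (simp add: G_sum GH G(3))
      then show ?thesis
        by (simp add: E_def R_sum R(2) \<sigma>.hom_sum \<sigma>.hom_mult)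
    qed
    have expand: "x = (\<Sum>c\<in>B. E x c *s G c)" for x
    proof -
      have "x = G (\<Sum>c\<in>B. R (H x) c *s c)"
        by (simp add: R(4) GH)
      then show ?thesis
        by (simp add: G_sum G(3) E_def)
    qed
    have "endo_trace T' = (\<Sum>b\<in>B. R (T' b) b)"
      by (simp add: endo_trace_def B_def R_def Let_def)
    also have "\<dots> = (\<Sum>b\<in>B. R (\<Sum>c\<in>B. E (T' b) c *s G c) b)"
      by (simp only: expand[symmetric])
    also have "\<dots> = (\<Sum>b\<in>B. \<Sum>c\<in>B. R (G c) b * E (T' b) c)"
      by (simp add: R_sum R(2) mult.commute)
    also have "\<dots> = (\<Sum>c\<in>B. \<Sum>b\<in>B. R (G c) b * E (T' b) c)"
      by (rule sum.swap)
    \<comment> \<open>For fixed \<open>c\<close>, the factors \<open>R (G c) b\<close> are the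
      coordinates of \<open>G c\<close> in \<open>B\<close>; linearity of \<open>T'\<close> and
      \<open>E\<close> reassembles the inner sum.\<close>
    also have "\<dots> = (\<Sum>c\<in>B. E (T' (G c)) c)"
    proof (rule sum.cong)
      fix c
      have "T' (G c) = T' (\<Sum>b\<in>B. R (G c) b *s b)"
        by (simp add: R(4))
      also have "\<dots> = (\<Sum>b\<in>B. R (G c) b *s T' b)"
        by (simp add: T'.sum T'.scale)
      finally show "(\<Sum>b\<in>B. R (G c) b * E (T' b) c) = E (T' (G c)) c"
        by (simp only: E_sum)
    qed simp
    also have "\<dots> = (\<Sum>c\<in>B. \<sigma> (R (T c) c))"
      by (simp add: E_def T'_G GH)
    also have "\<dots> = \<sigma> (endo_trace T)"
      by (simp add: endo_trace_def B_def R_def Let_def \<sigma>.hom_sum)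
    finally show ?thesis .
  qed
qed

section \<open>Generated ideals and reflexive hulls under automorphisms\<close>

lemma ideal_ring_on_UNIV_iff:
  "ideal I (ring_on UNIV) \<longleftrightarrow>
    0 \<in> I \<and> (\<forall>x\<in>I. \<forall>y\<in>I. x + y \<in> I) \<and> (\<forall>r. \<forall>x\<in>I. r * x \<in> I)"
    for I :: "'r::comm_ring_1 set"
proof
  assume "ideal I (ring_on UNIV)"
  then interpret ideal I "ring_on (UNIV :: 'r set)" .
  show "0 \<in> I \<and> (\<forall>x\<in>I. \<forall>y\<in>I. x + y \<in> I) \<and> (\<forall>r. \<forall>x\<in>I. r * x \<in> I)"
    using additive_subgroup.zero_closed[OF is_additive_subgroup]
      additive_subgroup.a_closed[OF is_additive_subgroup] I_l_closed
    by (simp add: ring_on_def)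
next
  assume I: "0 \<in> I \<and> (\<forall>x\<in>I. \<forall>y\<in>I. x + y \<in> I) \<and> (\<forall>r. \<forall>x\<in>I. r * x \<in> I)"
  have ring: "ring (ring_on (UNIV :: 'r set))"
    by (intro ringI abelian_groupI monoidI)
      (auto simp: ring_on_def algebra_simps intro: exI[of _ "- _"])
  then interpret ring "ring_on (UNIV :: 'r set)" .
  show "ideal I (ring_on UNIV)"
  proof (rule idealI[OF ring])
    show "subgroup I (add_monoid (ring_on UNIV))"
    proof
      fix x assume x: "x \<in> I"
      have "\<ominus>\<^bsub>ring_on UNIV\<^esub> x = - x"
        by (rule minus_equality) (simp_all add: ring_on_def)
      then have "inv\<^bsub>add_monoid (ring_on UNIV)\<^esub> x = - x"
        by (simp add: a_inv_def)
      moreover have "(- 1) * x \<in> I"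
        using I x by blast
      ultimately show "inv\<^bsub>add_monoid (ring_on UNIV)\<^esub> x \<in> I"
        by simp
    qed (use I in \<open>simp_all add: ring_on_def\<close>)
      show "x \<otimes>\<^bsub>ring_on UNIV\<^esub> a \<in> I" if "a \<in> I" for a x
      using I that by (simp add: ring_on_def)
    then show "a \<otimes>\<^bsub>ring_on UNIV\<^esub> x \<in> I" if "a \<in> I" for a x
      using that by (simp add: ring_on_def mult.commute[of a])
  qed
qed

text \<open>If an ideal contains \<open>S\<close>, its preimage under \<open>\<sigma>\<close> is an
  ideal that also contains \<open>S\<close>, hence contains the ideal generated by
  \<open>S\<close>.\<close>

lemma ring_automorphism_image_genideal:
  fixes \<sigma> :: "'r::comm_ring_1 \<Rightarrow> 'r"
  assumes "ring_automorphism \<sigma>" and "\<sigma> ` S \<subseteq> S"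
  shows "\<sigma> ` genideal (ring_on UNIV) S \<subseteq> genideal (ring_on UNIV) S"
proof -
  interpret ring_automorphism \<sigma> by fact
  have "\<sigma> x \<in> I" if x: "x \<in> genideal (ring_on UNIV) S"
    and I: "ideal I (ring_on UNIV)" "S \<subseteq> I" for x I
  proof -
    have "ideal (\<sigma> -` I) (ring_on UNIV)"
      using I(1) by (simp add: ideal_ring_on_UNIV_iff hom_distribs)
    moreover have "S \<subseteq> \<sigma> -` I"
      using assms(2) I(2) by blast
    ultimately show ?thesis
      using x unfolding genideal_def by blast
  qed
  then show ?thesis
    unfolding genideal_def[of _ S] by blast
qed

text \<open>Conjugation by \<open>\<sigma>\<close> acts on the dual of \<open>I\<close> because
  \<open>\<sigma>\<close> preserves \<open>I\<close>. It carries a functional on the dual to another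
  one and fixes the inclusion of \<open>I\<close>, so the value at the inclusion is moved by
  \<open>\<sigma>\<close>.\<close>

lemma ring_automorphism_image_reflexive_hull:
  fixes \<sigma> :: "'r::comm_ring_1 \<Rightarrow> 'r"
  assumes "ring_automorphism \<sigma>" and \<sigma>I: "\<sigma> ` I = I"
  shows "\<sigma> ` reflexive_hull I \<subseteq> reflexive_hull I"
proof (rule image_subsetI)
  interpret ring_automorphism \<sigma> by fact
  have mem: "\<sigma> x \<in> I \<longleftrightarrow> x \<in> I" for x
    using \<sigma>I by (metis apply_eq_iff imageE imageI)
  define conj where "conj f = the_inv \<sigma> \<circ> f \<circ> \<sigma>" for f :: "'r \<Rightarrow> 'r"
  interpret inv: ring_automorphism "the_inv \<sigma>"
    by (rule ring_automorphism_inv)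
  \<comment> \<open>Both directions matter: elements of the double dual must vanish outside the
    dual, so \<open>conj\<close> must also map the complement of the dual into itself.\<close>
  have conj_mem: "conj f \<in> dual (*) I \<longleftrightarrow> f \<in> dual (*) I" for f
  proof
    assume "f \<in> dual (*) I"
    then show "conj f \<in> dual (*) I"
      by (simp add: dual_def conj_def mem hom_distribs inv.hom_add inv.hom_mult)
  next
    define h where "h = conj f"
    assume "conj f \<in> dual (*) I"
    then have h: "\<And>x y. x \<in> I \<Longrightarrow> y \<in> I \<Longrightarrow> h (x + y) = h x + h y"
      "\<And>r x. x \<in> I \<Longrightarrow> h (r * x) = r * h x" "\<And>x. x \<notin> I \<Longrightarrow> h x = 0"
      by (auto simp: dual_def h_def)
    have f_eq: "f = (\<lambda>x. \<sigma> (h (the_inv \<sigma> x)))"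
      by (simp add: h_def conj_def fun_eq_iff)
    have inv_mem: "the_inv \<sigma> x \<in> I \<longleftrightarrow> x \<in> I" for x
      using mem[of "the_inv \<sigma> x"] by simp
    show "f \<in> dual (*) I"
      unfolding dual_def f_eq by (simp add: h inv_mem inv.hom_add inv.hom_mult hom_distribs)
  qed
  fix x assume "x \<in> reflexive_hull I"
  then obtain \<phi> where \<phi>: "\<phi> \<in> dual (\<lambda>r f x. r * f x) (dual (*) I)"
    and x: "x = \<phi> (\<lambda>x. if x \<in> I then x else 0)"
    by (auto simp: reflexive_hull_def)
  \<comment> \<open>\<open>conj\<close> turns scaling by \<open>r\<close> into scaling by the
    inverse image of \<open>r\<close>; the outer \<open>\<sigma>\<close> turns this back, so
    \<open>\<psi>\<close> is linear.\<close>
  define \<psi> where "\<psi> f = \<sigma> (\<phi> (conj f))" for f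
  have "conj (f + h) = conj f + conj h" "conj (\<lambda>x. r * f x) = (\<lambda>x. the_inv \<sigma> r * conj f x)" for f h r
    by (simp_all add: conj_def fun_eq_iff inv.hom_add inv.hom_mult)
  then have "\<psi> \<in> dual (\<lambda>r f x. r * f x) (dual (*) I)"
    using \<phi> by (simp add: dual_def[of _ "dual _ _"] \<psi>_def conj_mem hom_distribs)
  moreover have "conj (\<lambda>x. if x \<in> I then x else 0) = (\<lambda>x. if x \<in> I then x else 0)"
    by (auto simp: conj_def mem)
  then have "\<sigma> x = \<psi> (\<lambda>x. if x \<in> I then x else 0)"
    by (simp add: \<psi>_def x)
  ultimately show "\<sigma> x \<in> reflexive_hull I"
    unfolding reflexive_hull_def by blast
qed

section \<open>Extension to the fraction field\<close>

definition fract_map :: "('r::idom \<Rightarrow> 'r) \<Rightarrow> 'r fract \<Rightarrow> 'r fract"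
  where "fract_map \<sigma> q = (SOME r. \<exists>a b. b \<noteq> 0 \<and> q = Fract a b \<and> r = Fract (\<sigma> a) (\<sigma> b))"

text \<open>The chosen representative does not matter: \<open>\<sigma>\<close> preserves the
  cross-multiplication identity between two representatives, and injectivity keeps denominators
  non-zero.\<close>

lemma fract_map_Fract:
  assumes "ring_automorphism \<sigma>" and b: "b \<noteq> 0"
  shows "fract_map \<sigma> (Fract a b) = Fract (\<sigma> a) (\<sigma> b)"
  unfolding fract_map_def
proof (rule someI2)
  interpret ring_automorphism \<sigma> by fact
  show "\<exists>a' b'. b' \<noteq> 0 \<and> Fract a b = Fract a' b' \<and> Fract (\<sigma> a) (\<sigma> b) = Fract (\<sigma> a') (\<sigma> b')"
    using b by blast
  fix r assume "\<exists>a' b'. b' \<noteq> 0 \<and> Fract a b = Fract a' b' \<and> r = Fract (\<sigma> a') (\<sigma> b')"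
  then obtain a' b' where "b' \<noteq> 0" "Fract a b = Fract a' b'" "r = Fract (\<sigma> a') (\<sigma> b')"
    by blast
  then show "r = Fract (\<sigma> a) (\<sigma> b)"
    using b by (simp add: eq_fract hom_mult[symmetric])
qed

lemma fract_map_to_fract:
  "ring_automorphism \<sigma> \<Longrightarrow> fract_map \<sigma> (to_fract a) = to_fract (\<sigma> a)"
  using fract_map_Fract[of \<sigma> 1 a] unfolding to_fract_def
  by (simp add: one_hom.hom_one[OF monoid_mult_hom.axioms(1)] ring_automorphism_def ring_hom_def
      semiring_hom_def)

lemma fract_map_inv:
  assumes "ring_automorphism \<sigma>"
  shows "fract_map (the_inv \<sigma>) (fract_map \<sigma> q) = q"
proof -
  interpret ring_automorphism \<sigma> by fact
  show ?thesis
    by (cases q) (simp add: fract_map_Fract assms ring_automorphism_inv)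
qed

lemma ring_automorphism_fract_map:
  assumes \<sigma>: "ring_automorphism \<sigma>"
  shows "ring_automorphism (fract_map \<sigma>)"
proof
  interpret ring_automorphism \<sigma> by fact
  fix p q :: "'a fract"
  show "fract_map \<sigma> 0 = 0" "fract_map \<sigma> 1 = 1"
    using fract_map_Fract[OF \<sigma>, of 1] by (simp_all add: Zero_fract_def One_fract_def)
  obtain a b c e where "p = Fract a b" "b \<noteq> 0" "q = Fract c e" "e \<noteq> 0"
    by (metis Fract_cases)
  then show "fract_map \<sigma> (p + q) = fract_map \<sigma> p + fract_map \<sigma> q"
    "fract_map \<sigma> (p * q) = fract_map \<sigma> p * fract_map \<sigma> q"
    by (simp_all add: fract_map_Fract[OF \<sigma>] hom_distribs)
  show "bij (fract_map \<sigma>)"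
    using fract_map_inv[OF \<sigma>] fract_map_inv[OF ring_automorphism_inv, unfolded inv_inv]
    by (metis bijI')
qed

section \<open>Restriction to the center\<close>

definition center_map :: "('a::ring_1 \<Rightarrow> 'a) \<Rightarrow> 'a center \<Rightarrow> 'a center"
  where "center_map g z = Abs_center (g (of_center z))"

context ring_automorphism
begin

text \<open>Surjectivity is what keeps central elements central: every \<open>a\<close> is the image
  of \<open>the_inv g a\<close>, which commutes with \<open>of_center z\<close>.\<close>

lemma of_center_center_map: "of_center (center_map g z) = g (of_center z)"
proof -
  have "g (of_center z) * a = a * g (of_center z)" for a
    using arg_cong[OF of_center_commute[of z "the_inv g a"], of g] by (simp add: hom_mult)
  then show ?thesis
    by (simp add: center_map_def Abs_center_inverse)
qed

lemma center_map_inv: "center_map (the_inv g) (center_map g z) = z"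
proof -
  interpret inv: ring_automorphism "the_inv g"
    by (rule ring_automorphism_inv)
  show ?thesis
    by (simp add: of_center_inject[symmetric] of_center_center_map inv.of_center_center_map)
qed

end

lemma ring_automorphism_center_map:
  assumes "ring_automorphism g"
  shows "ring_automorphism (center_map g)" and "the_inv (center_map g) = center_map (the_inv g)"
proof -
  interpret ring_automorphism g by fact
  have inverse: "center_map (the_inv g) (center_map g z) = z"
    "center_map g (center_map (the_inv g) z) = z" for z
    using center_map_inv ring_automorphism.center_map_inv[OF ring_automorphism_inv, of z]
    by (simp_all add: inv_inv)
  then show "the_inv (center_map g) = center_map (the_inv g)"
    by (intro the_inv_eqI)
  show "ring_automorphism (center_map g)"
  proof
    show "bij (center_map g)"
      using inverse by (metis bijI')
  qed (simp_all add: of_center_inject[symmetric] of_center_center_map plus_center.rep_eq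
      times_center.rep_eq zero_center.rep_eq one_center.rep_eq hom_distribs)
qed

section \<open>Semilinear action on the scalar extension, the trace and the discriminant\<close>

definition frac_ext_map :: "('a::prime_ring \<Rightarrow> 'a) \<Rightarrow> 'a frac_ext \<Rightarrow> 'a frac_ext"
  where "frac_ext_map g t = abs_frac_ext
    (frag_extend (\<lambda>(a, f). frag_of (g a, fract_map (center_map g) f)) (rep_frac_ext t))"

locale prime_ring_automorphism = ring_automorphism g
  for g :: "'a::prime_ring \<Rightarrow> 'a"
begin

sublocale center: ring_automorphism "center_map g"
  by (intro ring_automorphism_center_map) unfold_locales

sublocale fract: ring_automorphism "fract_map (center_map g)"
  by (intro ring_automorphism_fract_map) unfold_locales

text \<open>Well-definedness of \<open>g\<close> tensored with its extension to fractions. The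
  balancing relation survives because both factors act on central scalars through
  \<open>center_map g\<close>.\<close>

lemma frac_ext_map_abs:
  "frac_ext_map g (abs_frac_ext x) =
    abs_frac_ext (frag_extend (\<lambda>(a, f). frag_of (g a, fract_map (center_map g) f)) x)"
  unfolding frac_ext_map_def
proof (rule abs_frac_ext_cong)
  let ?\<sigma> = "fract_map (center_map g)"
  fix x :: "('a \<times> 'a center fract) \<Rightarrow>\<^sub>0 int"
  assume "x \<in> tensor_relations"
  then show "frag_extend (\<lambda>(a, f). frag_of (g a, ?\<sigma> f)) x \<in> tensor_relations"
  proof induction
    case (balanced z a f)
    show ?case
      using tensor_relations.balanced[of "center_map g z" "g a" "?\<sigma> f"]
      by (simp add: frag_extend_diff hom_mult fract.hom_mult of_center_center_map
          fract_map_to_fract[OF center.ring_automorphism_axioms])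
  next
    case (add_left a b f)
    show ?case
      using tensor_relations.add_left[of "g a" "g b" "?\<sigma> f"]
      by (simp add: frag_extend_diff hom_add)
  next
    case (add_right a f h)
    show ?case
      using tensor_relations.add_right[of "g a" "?\<sigma> f" "?\<sigma> h"]
      by (simp add: frag_extend_diff fract.hom_add)
  next
    case (diff x y)
    then show ?case
      unfolding frag_extend_diff by (intro tensor_relations.diff)
  next
    case zero
    show ?case
      by (simp add: tensor_relations.zero)
  qed
qed

lemma frac_ext_map_tensor: "frac_ext_map g (tensor a f) = tensor (g a) (fract_map (center_map g) f)"
  by (simp add: tensor_def frac_ext_map_abs)

lemma frac_ext_map_diff: "frac_ext_map g (s - t) = frac_ext_map g s - frac_ext_map g t"
proof -
  obtain x y where "s = abs_frac_ext x" "t = abs_frac_ext y"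
    by (meson frac_ext_cases)
  then show ?thesis
    by (simp add: minus_frac_ext.abs_eq frac_ext_map_abs frag_extend_diff)
qed

lemma frac_ext_map_0: "frac_ext_map g 0 = 0"
  using frac_ext_map_diff[of 0 0] by simp

lemma frac_ext_map_add: "frac_ext_map g (s + t) = frac_ext_map g s + frac_ext_map g t"
  using frac_ext_map_diff[of "s + t" t] by (simp add: algebra_simps)

lemma frac_ext_map_frac_scale:
  "frac_ext_map g (frac_scale f t) = frac_scale (fract_map (center_map g) f) (frac_ext_map g t)"
  by (induction t rule: frac_ext_induct)
    (simp_all add: frac_ext_map_0 frac_ext_map_diff frac_scale_diff frac_scale_tensor
      frac_ext_map_tensor fract.hom_mult)

lemma left_mult_frac_ext_map: "left_mult (g a) (frac_ext_map g t) = frac_ext_map g (left_mult a t)"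
proof -
  have "left_mult b 0 = 0" for b :: 'a
    using left_mult_diff[of b 0 0] by simp
  then show ?thesis
    by (induction t rule: frac_ext_induct)
      (simp_all add: frac_ext_map_0 frac_ext_map_diff left_mult_diff left_mult_tensor
        frac_ext_map_tensor hom_mult)
qed

lemma prime_ring_automorphism_inv: "prime_ring_automorphism (the_inv g)"
  using ring_automorphism_inv by (rule prime_ring_automorphism.intro)

lemma frac_ext_map_inv: "frac_ext_map (the_inv g) (frac_ext_map g t) = t"
proof -
  interpret inv: prime_ring_automorphism "the_inv g"
    by (rule prime_ring_automorphism_inv)
  have "fract_map (center_map (the_inv g)) (fract_map (center_map g) f) = f" for f
    using fract_map_inv[OF center.ring_automorphism_axioms]
    by (simp add: ring_automorphism_center_map(2)[OF ring_automorphism_axioms])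
  then show ?thesis
    by (induction t rule: frac_ext_induct)
      (simp_all add: frac_ext_map_0 inv.frac_ext_map_0 frac_ext_map_diff inv.frac_ext_map_diff
        frac_ext_map_tensor inv.frac_ext_map_tensor)
qed

lemma bij_frac_ext_map: "bij (frac_ext_map g)"
  using frac_ext_map_inv
    prime_ring_automorphism.frac_ext_map_inv[OF prime_ring_automorphism_inv, unfolded inv_inv]
  by (metis bijI')

text \<open>\<open>frac_ext_map g\<close> is a semilinear bijection intertwining left multiplication
  by \<open>a\<close> with that by \<open>g a\<close>, so \<open>endo_trace_semilinear\<close>
  applies.\<close>

lemma regular_trace_apply: "regular_trace (g a) = fract_map (center_map g) (regular_trace a)"
  unfolding regular_trace_def
  by (rule frac_ext.endo_trace_semilinear[where G = "frac_ext_map g"])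
    (simp_all add: fract.ring_automorphism_axioms bij_frac_ext_map frac_ext_map_add
      frac_ext_map_frac_scale linear_left_mult left_mult_frac_ext_map)

text \<open>Generators go to generators: composing both families with \<open>g\<close> keeps them
  injective and applies \<open>fract_map (center_map g)\<close> to every matrix entry. Determinants
  commute with ring homomorphisms.\<close>

lemma image_modified_discriminant_ideal_subset:
  "center_map g ` modified_discriminant_ideal TYPE('a) \<subseteq> modified_discriminant_ideal TYPE('a)"
  unfolding modified_discriminant_ideal_def
proof (rule ring_automorphism_image_genideal[OF center.ring_automorphism_axioms], unfold Let_def,
    rule image_subsetI, unfold mem_Collect_eq, elim exE conjE)
  interpret hom: comm_ring_hom "fract_map (center_map g)" ..
  let ?w = "regular_rank TYPE('a)"
  fix z :: "'a center" and u u' :: "nat \<Rightarrow> 'a"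
  assume u: "inj_on u {..<?w}" "inj_on u' {..<?w}"
    and z: "to_fract z = det (mat ?w ?w
      (\<lambda>(i, j). regular_trace (u i * u' j)))"
  have "to_fract (center_map g z) = fract_map (center_map g) (to_fract z)"
    by (simp add: fract_map_to_fract[OF center.ring_automorphism_axioms])
  also have "\<dots> = det (map_mat (fract_map (center_map g))
      (mat ?w ?w (\<lambda>(i, j). regular_trace (u i * u' j))))"
    by (simp add: z)
  also have "map_mat (fract_map (center_map g)) (mat ?w ?w (\<lambda>(i, j). regular_trace (u i * u' j)))
      = mat ?w ?w (\<lambda>(i, j). regular_trace ((g \<circ> u) i * (g \<circ> u') j))"
    by (rule eq_matI) (simp_all add: regular_trace_apply[symmetric] hom_mult)
  finally have "to_fract (center_map g z) =
      det (mat ?w ?w (\<lambda>(i, j). regular_trace ((g \<circ> u) i * (g \<circ> u') j)))" .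
  moreover have "inj_on (g \<circ> u) {..<?w}" "inj_on (g \<circ> u') {..<?w}"
    using u by (simp_all add: inj_on_def)
  ultimately show "\<exists>u u'. inj_on u {..<?w} \<and> inj_on u' {..<?w} \<and>
      to_fract (center_map g z) = det (mat ?w ?w
        (\<lambda>(i, j). regular_trace (u i * u' j)))"
    by blast
qed

lemma image_modified_discriminant_ideal:
  "center_map g ` modified_discriminant_ideal TYPE('a) = modified_discriminant_ideal TYPE('a)"
proof (rule antisym[OF image_modified_discriminant_ideal_subset], rule subsetI)
  fix z assume z: "z \<in> modified_discriminant_ideal TYPE('a)"
  have "the_inv (center_map g) z \<in> modified_discriminant_ideal TYPE('a)"
    using z prime_ring_automorphism.image_modified_discriminant_ideal_subset[OF prime_ring_automorphism_inv]
    by (auto simp: ring_automorphism_center_map(2)[OF ring_automorphism_axioms])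
  then show "z \<in> center_map g ` modified_discriminant_ideal TYPE('a)"
    by (intro image_eqI[of _ _ "the_inv (center_map g) z"]) simp_all
qed

text \<open>The reflexive hull is stable under \<open>center_map g\<close> and contains its
  generator \<open>d\<close>, so the image of \<open>d\<close> is a multiple of
  \<open>d\<close>.\<close>

lemma R_discriminant_dvd:
  assumes "R_discriminant d"
  shows "d dvd center_map g d"
proof -
  let ?I = "modified_discriminant_ideal TYPE('a)"
  have I: "reflexive_hull ?I = range ((*) d)"
    using assms by (simp add: R_discriminant_def)
  have "center_map g ` reflexive_hull ?I \<subseteq> reflexive_hull ?I"
    by (rule ring_automorphism_image_reflexive_hull[OF center.ring_automorphism_axioms
          image_modified_discriminant_ideal])
  moreover have "d \<in> range ((*) d)"
    by (rule range_eqI[of _ _ 1]) simp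
  ultimately have "center_map g d \<in> range ((*) d)"
    unfolding I by blast
  then show ?thesis
    by (auto simp: dvd_def)
qed

text \<open>Divisibility for \<open>g\<close> and for its inverse gives factors \<open>c\<close> and
  \<open>c'\<close> with \<open>d = d * (c * c')\<close>; cancelling \<open>d\<close> makes
  \<open>c\<close> a unit.\<close>

lemma R_discriminant_eq_up_to_unit:
  assumes d: "R_discriminant d"
  shows "eq_up_to_unit (g (of_center d)) (of_center d)"
proof -
  obtain c where c: "center_map g d = d * c"
    using R_discriminant_dvd[OF d] by (auto simp: dvd_def)
  have "d dvd center_map (the_inv g) d"
    using prime_ring_automorphism.R_discriminant_dvd[OF prime_ring_automorphism_inv d] .
  then have "center_map g d dvd center_map g (the_inv (center_map g) d)"
    unfolding ring_automorphism_center_map(2)[OF ring_automorphism_axioms]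
    by (auto simp: dvd_def center.hom_mult)
  then obtain c' where c': "d = center_map g d * c'"
    by (auto simp: dvd_def)
  have gd: "g (of_center d) = of_center d * of_center c"
    by (simp add: of_center_center_map[symmetric] c times_center.rep_eq)
  show ?thesis
  \<comment> \<open>Cancellation fails for \<open>d = 0\<close>, but then both sides are 0 and the
    unit 1 serves.\<close>
  proof (cases "d = 0")
    case True
    then show ?thesis
      unfolding eq_up_to_unit_def unit_group_def
      by (intro bexI[of _ 1]) (auto simp: zero_center.rep_eq intro: exI[of _ 1])
  next
    case False
    have "d * (c * c') = d * 1"
      using c' by (simp add: c mult.assoc)
    with False have "c * c' = 1"
      by (simp only: mult_cancel_left simp_thms)
    then have "of_center c * of_center c' = 1"
      by (simp add: times_center.rep_eq[symmetric] one_center.rep_eq)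
    then have "of_center c \<in> unit_group"
      unfolding unit_group_def by (auto simp: of_center_commute[of c])
    then show ?thesis
      unfolding eq_up_to_unit_def gd using of_center_commute[of d] by blast
  qed
qed

end

lemma algebra_automorphism_eq_up_to_unit:
  fixes scale :: "'k::field \<Rightarrow> 'a::prime_ring \<Rightarrow> 'a"
  assumes g: "algebra_automorphism scale g" and d: "R_discriminant d"
  shows "eq_up_to_unit (g (of_center d)) (of_center d)"
proof -
  interpret g: Vector_Spaces.linear scale scale g
    using g by (simp add: algebra_automorphism_def)
  interpret prime_ring_automorphism g
    using g by unfold_locales (simp_all add: algebra_automorphism_def g.add)
  show ?thesis
    by (rule R_discriminant_eq_up_to_unit[OF d])
qed

section \<open>Exponentials of locally nilpotent derivations\<close>

locale locally_nilpotent_derivation = field_algebra scale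
  for scale :: "'k::field \<Rightarrow> 'a::ring_1 \<Rightarrow> 'a" (infixr \<open>*s\<close> 75) +
  fixes \<delta> :: "'a \<Rightarrow> 'a"
  assumes char_0: "CHAR('k) = 0"
    and derivation: "derivation (*s) \<delta>"
    and locally_nilpotent: "locally_nilpotent \<delta>"
begin

sublocale \<delta>: Vector_Spaces.linear "(*s)" "(*s)" \<delta>
  using derivation by (simp add: derivation_def)

lemma leibniz: "\<delta> (a * b) = \<delta> a * b + a * \<delta> b"
  using derivation by (simp add: derivation_def)

section \<open>Divided powers and the exponential series\<close>

lemma of_nat_neq_0: "n \<noteq> 0 \<Longrightarrow> (of_nat n :: 'k) \<noteq> 0"
  using char_0 by (simp add: of_nat_eq_0_iff_char_dvd)

definition divided_power :: "nat \<Rightarrow> 'a \<Rightarrow> 'a"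
  where "divided_power n a = inverse (of_nat (fact n)) *s (\<delta> ^^ n) a"

text \<open>Summing over the non-zero terms avoids choosing a bound for each element; local
  nilpotence makes the index set finite.\<close>

definition exponential :: "'a \<Rightarrow> 'a"
  where "exponential a = (\<Sum>n | divided_power n a \<noteq> 0. divided_power n a)"

lemma divided_power_0 [simp]: "divided_power 0 a = a"
  by (simp add: divided_power_def)

lemma divided_power_Suc: "of_nat (Suc n) *s divided_power (Suc n) a = \<delta> (divided_power n a)"
proof -
  have "of_nat (Suc n) * inverse (of_nat (fact (Suc n))) = (inverse (of_nat (fact n)) :: 'k)"
    using of_nat_neq_0[of "Suc n"]
    by (simp only: fact_Suc of_nat_mult of_nat_id inverse_mult_distrib)
      (simp add: mult.assoc[symmetric] del: of_nat_Suc)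
  then show ?thesis
    unfolding divided_power_def by (simp add: \<delta>.scale del: of_nat_Suc fact_Suc)
qed

lemma linear_divided_power: "Vector_Spaces.linear (*s) (*s) (divided_power n)"
proof -
  have "(\<delta> ^^ n) (a + b) = (\<delta> ^^ n) a + (\<delta> ^^ n) b" "(\<delta> ^^ n) (c *s a) = c *s (\<delta> ^^ n) a" for a b c
    by (induction n) (simp_all add: \<delta>.add \<delta>.scale)
  then show ?thesis
    by unfold_locales (simp_all add: divided_power_def scale_right_distrib mult.commute)
qed

lemmas divided_power_add = module_hom.add[OF linear_divided_power[unfolded linear_iff_module_hom]]
lemmas divided_power_scale = module_hom.scale[OF linear_divided_power[unfolded linear_iff_module_hom]]

lemma divided_power_derivation: "divided_power n (\<delta> a) = \<delta> (divided_power n a)"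
  by (simp add: divided_power_def \<delta>.scale funpow_swap1)

lemma divided_power_eventually_0:
  obtains n where "\<And>i. i \<ge> n \<Longrightarrow> divided_power i a = 0"
proof -
  obtain n where n: "(\<delta> ^^ n) a = 0"
    using locally_nilpotent by (auto simp: locally_nilpotent_def)
  have "(\<delta> ^^ i) 0 = 0" for i
    by (induction i) simp_all
  then have "(\<delta> ^^ i) a = 0" if "i \<ge> n" for i
    using n that funpow_add[of "i - n" n \<delta>] by simp
  then have "divided_power i a = 0" if "i \<ge> n" for i
    using that by (simp add: divided_power_def)
  then show ?thesis
    by (rule that)
qed

text \<open>The bound \<open>n\<close> is arbitrary, so exponentials of several elements can be
  written over one common range.\<close>

lemma exponential_eq:
  assumes "\<And>i. i \<ge> n \<Longrightarrow> divided_power i a = 0"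
  shows "exponential a = (\<Sum>i<n. divided_power i a)"
  unfolding exponential_def
  by (rule sum.mono_neutral_left) (use assms not_le_imp_less in auto)

text \<open>The Leibniz formula, which has no binomial coefficients in terms of divided powers. In
  the induction step everything is multiplied by \<open>Suc n\<close>: differentiating the left
  factors weights the \<open>i\<close>-th term by \<open>i\<close>, the right factors by
  \<open>Suc n - i\<close>, and the weights add up to \<open>Suc n\<close>.\<close>

lemma divided_power_mult:
  "divided_power n (a * b) = (\<Sum>i\<le>n. divided_power i a * divided_power (n - i) b)"
proof (induction n)
  case 0
  show ?case by simp
next
  case (Suc n)
  define f where "f i = divided_power i a * divided_power (Suc n - i) b" for i
  have "of_nat (Suc n) *s divided_power (Suc n) (a * b)
      = \<delta> (\<Sum>i\<le>n. divided_power i a * divided_power (n - i) b)"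
    by (simp only: divided_power_Suc Suc.IH)
  also have "\<dots> = (\<Sum>i\<le>n. \<delta> (divided_power i a) * divided_power (n - i) b)
      + (\<Sum>i\<le>n. divided_power i a * \<delta> (divided_power (n - i) b))"
    by (simp add: \<delta>.sum leibniz sum.distrib)
  also have "(\<Sum>i\<le>n. \<delta> (divided_power i a) * divided_power (n - i) b)
      = (\<Sum>i\<le>n. of_nat (Suc i) *s f (Suc i))"
    unfolding divided_power_Suc[symmetric]
    by (simp add: scale_mult_left f_def del: of_nat_Suc)
  \<comment> \<open>The new term \<open>i = 0\<close> has weight 0; in the second sum below, the
    same holds for \<open>i = Suc n\<close>.\<close>
  also have "\<dots> = (\<Sum>i\<le>Suc n. of_nat i *s f i)"
    unfolding sum.atMost_Suc_shift by simp
  also have "(\<Sum>i\<le>n. divided_power i a * \<delta> (divided_power (n - i) b))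
      = (\<Sum>i\<le>n. of_nat (Suc n - i) *s f i)"
    unfolding divided_power_Suc[symmetric]
    by (intro sum.cong) (simp_all add: scale_mult_right f_def Suc_diff_le del: of_nat_Suc)
  also have "\<dots> = (\<Sum>i\<le>Suc n. of_nat (Suc n - i) *s f i)"
    by simp
  also have "(\<Sum>i\<le>Suc n. of_nat i *s f i) + (\<Sum>i\<le>Suc n. of_nat (Suc n - i) *s f i)
      = (\<Sum>i\<le>Suc n. of_nat (Suc n) *s f i)"
    unfolding sum.distrib[symmetric] scale_left_distrib[symmetric] of_nat_add[symmetric]
    by (intro sum.cong) simp_all
  also have "\<dots> = of_nat (Suc n) *s (\<Sum>i\<le>Suc n. f i)"
    by (simp only: scale_sum_right)
  finally show ?case
    unfolding f_def by (rule scale_left_imp_eq[OF of_nat_neq_0[OF nat.distinct(2)]])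
qed

lemma exponential_mult: "exponential (a * b) = exponential a * exponential b"
proof -
  obtain p where p: "\<And>i. i \<ge> p \<Longrightarrow> divided_power i a = 0"
    using divided_power_eventually_0[of a] by blast
  obtain q where q: "\<And>i. i \<ge> q \<Longrightarrow> divided_power i b = 0"
    using divided_power_eventually_0[of b] by blast
  have vanish: "divided_power i a * divided_power j b = 0" if "\<not> (i < p \<and> j < q)" for i j
    using that p[of i] q[of j] by auto
  \<comment> \<open>Indices adding up to at least \<open>p + q\<close> cannot satisfy both
    \<open>i < p\<close> and \<open>j < q\<close>.\<close>
  have "divided_power n (a * b) = 0" if "n \<ge> p + q" for n
    unfolding divided_power_mult using that by (intro sum.neutral ballI vanish) auto
  then have "exponential (a * b) = (\<Sum>n<p + q. divided_power n (a * b))"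
    by (rule exponential_eq)
  also have "\<dots> = (\<Sum>(i, j) \<in> {(i, j). i + j < p + q}. divided_power i a * divided_power j b)"
    by (simp only: divided_power_mult sum.triangle_reindex)
  \<comment> \<open>The rectangle lies inside the triangle, and the terms in between vanish.\<close>
  also have "\<dots> = (\<Sum>(i, j) \<in> {..<p} \<times> {..<q}. divided_power i a * divided_power j b)"
  proof (rule sum.mono_neutral_right)
    show "finite {(i, j). i + j < p + q}"
      by (rule finite_subset[of _ "{..<p + q} \<times> {..<p + q}"]) auto
  qed (auto intro: vanish)
  also have "\<dots> = exponential a * exponential b"
    by (simp add: exponential_eq[OF p] exponential_eq[OF q] sum_product sum.cartesian_product)
  finally show ?thesis .
qed

lemma linear_exponential: "Vector_Spaces.linear (*s) (*s) exponential"
proof -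
  have "exponential (a + b) = exponential a + exponential b" for a b
  proof -
    obtain p where p: "\<And>i. i \<ge> p \<Longrightarrow> divided_power i a = 0"
      using divided_power_eventually_0[of a] by blast
    obtain q where q: "\<And>i. i \<ge> q \<Longrightarrow> divided_power i b = 0"
      using divided_power_eventually_0[of b] by blast
    have "exponential x = (\<Sum>i<p + q. divided_power i x)" if "x \<in> {a, b, a + b}" for x
      using that by (intro exponential_eq) (auto simp: p q divided_power_add)
    then show ?thesis
      by (simp add: divided_power_add sum.distrib)
  qed
  moreover have "exponential (c *s a) = c *s exponential a" for c a
  proof -
    obtain p where p: "\<And>i. i \<ge> p \<Longrightarrow> divided_power i a = 0"
      using divided_power_eventually_0[of a] by blast
    have "exponential x = (\<Sum>i<p. divided_power i x)" if "x \<in> {a, c *s a}" for x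
      using that by (intro exponential_eq) (auto simp: p divided_power_scale)
    then show ?thesis
      by (simp add: divided_power_scale scale_sum_right)
  qed
  ultimately show ?thesis
    by unfold_locales
qed

sublocale exponential: Vector_Spaces.linear "(*s)" "(*s)" exponential
  by (rule linear_exponential)

lemma exponential_derivation: "exponential (\<delta> a) = \<delta> (exponential a)"
proof -
  obtain p where p: "\<And>i. i \<ge> p \<Longrightarrow> divided_power i a = 0"
    using divided_power_eventually_0[of a] by blast
  have "exponential (\<delta> a) = (\<Sum>i<p. divided_power i (\<delta> a))"
    by (rule exponential_eq) (simp add: p divided_power_derivation)
  then show ?thesis
    by (simp add: exponential_eq[OF p] divided_power_derivation \<delta>.sum)
qed

lemma exponential_funpow: "exponential ((\<delta> ^^ n) a) = (\<delta> ^^ n) (exponential a)"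
  by (induction n) (simp_all add: exponential_derivation)

lemma exponential_eq_add:
  assumes "\<delta> (\<delta> a) = 0"
  shows "exponential a = a + \<delta> a"
proof -
  have "(\<delta> ^^ i) a = 0" if "i \<ge> 2" for i
    using that by (induction i rule: dec_induct) (simp_all add: numeral_2_eq_2 assms)
  then have "exponential a = (\<Sum>i<2. divided_power i a)"
    by (intro exponential_eq) (simp add: divided_power_def)
  then show ?thesis
    by (simp add: numeral_2_eq_2 divided_power_def)
qed

section \<open>Local unipotency: bijectivity and eigenvectors of the exponential\<close>

lemma nilpotency_index:
  assumes "a \<noteq> 0"
  obtains n where "(\<delta> ^^ n) a \<noteq> 0" "(\<delta> ^^ Suc n) a = 0"
proof -
  define m where "m = (LEAST m. (\<delta> ^^ m) a = 0)"
  have m: "(\<delta> ^^ m) a = 0"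
    using locally_nilpotent LeastI_ex[of "\<lambda>m. (\<delta> ^^ m) a = 0"]
    by (simp add: m_def locally_nilpotent_def)
  with assms obtain n where n: "m = Suc n"
    by (cases m) simp_all
  then have "(\<delta> ^^ n) a \<noteq> 0"
    using not_less_Least[of n "\<lambda>m. (\<delta> ^^ m) a = 0"] by (simp add: m_def)
  with m n show ?thesis
    using that by simp
qed

text \<open>The exponential fixes the kernel of \<open>\<delta>\<close>. If it kills a non-zero
  \<open>a\<close>, it also kills the last non-zero iterate of \<open>\<delta>\<close> at
  \<open>a\<close>, which it fixes. For surjectivity, \<open>a - exponential a\<close> vanishes
  under a smaller power of \<open>\<delta>\<close> than \<open>a\<close> does, which allows
  induction.\<close>

lemma bij_exponential: "bij exponential"
proof (rule bijI)
  have "a = 0" if "exponential a = 0" for a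
  proof (rule ccontr)
    assume "a \<noteq> 0"
    then obtain n where n: "(\<delta> ^^ n) a \<noteq> 0" "(\<delta> ^^ Suc n) a = 0"
      by (rule nilpotency_index)
    then have "exponential ((\<delta> ^^ n) a) = (\<delta> ^^ n) a"
      by (simp add: exponential_eq_add)
    moreover have "exponential ((\<delta> ^^ n) a) = 0"
      unfolding exponential_funpow that by (induction n) simp_all
    ultimately show False
      using n by simp
  qed
  then show "inj exponential"
    by (metis eq_iff_diff_eq_0 exponential.diff injI)
  have "\<exists>b. a = exponential b" if "(\<delta> ^^ n) a = 0" for n a
    using that
  proof (induction n arbitrary: a)
    case 0
    then show ?case
      by (intro exI[of _ 0]) simp
  next
    case (Suc n)
    have "(\<delta> ^^ n) (x - y) = (\<delta> ^^ n) x - (\<delta> ^^ n) y" for x y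
      by (induction n) (simp_all add: \<delta>.diff)
    \<comment> \<open>\<open>(\<delta> ^^ n) a\<close> lies in the kernel of \<open>\<delta>\<close>
      and is therefore fixed.\<close>
    moreover have "(\<delta> ^^ n) (exponential a) = (\<delta> ^^ n) a"
      using Suc.prems by (simp add: exponential_funpow[symmetric] exponential_eq_add)
    ultimately have "(\<delta> ^^ n) (a - exponential a) = 0"
      by simp
    then obtain b where "a - exponential a = exponential b"
      using Suc.IH by blast
    then have "a = exponential (a + b)"
      by (simp add: exponential.add algebra_simps)
    then show ?case ..
  qed
  then show "surj exponential"
    using locally_nilpotent unfolding locally_nilpotent_def surj_def by blast
qed

lemma algebra_automorphism_exponential: "algebra_automorphism (*s) exponential"
proof -
  have "\<delta> 1 = 0"
    using leibniz[of 1 1] by simp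
  then have "exponential 1 = 1"
    by (simp add: exponential_eq_add)
  then show ?thesis
    unfolding algebra_automorphism_def
    using linear_exponential bij_exponential exponential_mult by blast
qed

text \<open>Otherwise some iterate \<open>b\<close> of \<open>\<delta>\<close> at \<open>a\<close>
  has \<open>\<delta> b\<close> non-zero but killed by \<open>\<delta>\<close>. Both are
  eigenvectors for \<open>c\<close>; as \<open>\<delta> b\<close> is fixed, \<open>c = 1\<close>,
  whereas \<open>b\<close> is sent to \<open>b + \<delta> b\<close>.\<close>

lemma derivation_eq_0_of_eigenvector:
  assumes "exponential a = c *s a"
  shows "\<delta> a = 0"
proof (rule ccontr)
  assume "\<delta> a \<noteq> 0"
  \<comment> \<open>The index is taken for \<open>\<delta> a\<close> rather than \<open>a\<close>,
    which places \<open>b\<close> exactly one step above the kernel.\<close>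
  then obtain n where n: "(\<delta> ^^ n) (\<delta> a) \<noteq> 0" "(\<delta> ^^ Suc n) (\<delta> a) = 0"
    by (rule nilpotency_index)
  define b where "b = (\<delta> ^^ n) a"
  have b: "\<delta> b \<noteq> 0" "\<delta> (\<delta> b) = 0"
    using n by (simp_all add: b_def funpow_swap1)
  have "(\<delta> ^^ m) (c *s a) = c *s (\<delta> ^^ m) a" for m
    by (induction m) (simp_all add: \<delta>.scale)
  then have exp_b: "exponential b = c *s b"
    unfolding b_def exponential_funpow assms by simp
  then have "exponential (\<delta> b) = c *s \<delta> b"
    by (simp add: exponential_derivation \<delta>.scale)
  then have "1 *s \<delta> b = c *s \<delta> b"
    using b by (simp add: exponential_eq_add)
  then have "c = 1"
    using b by (metis scale_right_imp_eq)
  with exp_b have "\<delta> b = 0"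
    using exponential_eq_add[of b] b by simp
  with b show False
    by simp
qed

end

section \<open>Invariance of the discriminant\<close>

theorem theorem0p3:
  fixes scale :: "'k::field \<Rightarrow> 'a::prime_ring \<Rightarrow> 'a"
    and d :: "'a center"
  assumes "field_algebra scale"
    and "affine_subalgebra scale (range (of_center :: 'a center \<Rightarrow> 'a))"
    and "cohen_macaulay_domain TYPE('a center)"
    and "finite_over_center TYPE('a)"
    and "range (regular_trace :: 'a \<Rightarrow> 'a center fract) \<subseteq> range to_fract"
    and "R_discriminant d"
  shows "(\<forall>g. algebra_automorphism scale g \<longrightarrow>
            eq_up_to_unit (g (of_center d)) (of_center d)) \<and>
         (CHAR('k) = 0 \<longrightarrow> (unit_group :: 'a set) = {scale c 1 | c. c \<noteq> 0} \<longrightarrow>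
            (\<forall>\<delta>. derivation scale \<delta> \<longrightarrow> locally_nilpotent \<delta> \<longrightarrow> \<delta> (of_center d) = 0))"
proof (intro conjI allI impI)
  show "eq_up_to_unit (g (of_center d)) (of_center d)" if "algebra_automorphism scale g" for g
    using that \<open>R_discriminant d\<close> by (rule algebra_automorphism_eq_up_to_unit)
next
  fix \<delta>
  assume "CHAR('k) = 0" and units: "(unit_group :: 'a set) = {scale c 1 | c. c \<noteq> 0}"
    and "derivation scale \<delta>" "locally_nilpotent \<delta>"
  then interpret locally_nilpotent_derivation scale \<delta>
    using \<open>field_algebra scale\<close>
    by (simp add: locally_nilpotent_derivation_def locally_nilpotent_derivation_axioms_def)
  have "eq_up_to_unit (exponential (of_center d)) (of_center d)"
    using algebra_automorphism_exponential \<open>R_discriminant d\<close>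
    by (rule algebra_automorphism_eq_up_to_unit)
  \<comment> \<open>The unit from the automorphism statement is a scalar, which turns
    \<open>of_center d\<close> into an eigenvector.\<close>
  then obtain c where "exponential (of_center d) = scale c 1 * of_center d"
    unfolding eq_up_to_unit_def units by blast
  then have "exponential (of_center d) = scale c (of_center d)"
    by (simp add: scale_mult_left)
  then show "\<delta> (of_center d) = 0"
    by (rule derivation_eq_0_of_eigenvector)
qed

end
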